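(* For all integers $n\geq 2$, $$\sum_{\lambda\vdash n}(-1)^{v(\lambda)}I_\lambda^2=0.$$
   Context: A shape $\lambda$ is the Ferrers diagram of an integer partition; $\lambda\vdash n$ means it has $n$ squares. A standard Young tableau (SYT) on an $n$-shape is a filling with $1,\ldots,n$, each once, increasing along rows and down columns. The sign $\mathrm{sgn}(T)$ of a tableau is the sign of the word obtained by reading its entries row by row, left to right, top to bottom; the sign of a word of distinct integers is $(-1)^{\#\text{inversions}}$. $I_\lambda=\sum_{T\in\mathrm{SYT}(\lambda)}\mathrm{sgn}(T)$. $v(\lambda)$ is the maximal number of disjoint vertical dominoes ($2\times1$ rectangles) that fit in $\lambda$. *)

theory Defs
  imports Main "HOL-Library.Disjoint_Sets"
begin

definition partitions_of :: "nat \<Rightarrow> nat list set" where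
  "partitions_of n =
     {\<mu>. sorted_wrt (\<ge>) \<mu> \<and> 0 \<notin> set \<mu> \<and> sum_list \<mu> = n}"

text \<open>Squares are pairs (row, column), counted from 0, rows numbered from top to bottom.\<close>

definition ferrers :: "nat list \<Rightarrow> (nat \<times> nat) set" where
  "ferrers \<mu> = {(i, j). i < length \<mu> \<and> j < \<mu> ! i}"

text \<open>A tableau is represented by the list of its rows, so that its reading word is \<open>concat T\<close>.\<close>

definition SYT :: "nat list \<Rightarrow> nat list list set" where
  "SYT \<mu> =
     {T. map length T = \<mu> \<and>
         distinct (concat T) \<and> set (concat T) = {1..sum_list \<mu>} \<and>
         (\<forall>i j. (i, j) \<in> ferrers \<mu> \<and> (i, Suc j) \<in> ferrers \<mu> \<longrightarrow> T ! i ! j < T ! i ! Suc j) \<and>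
         (\<forall>i j. (i, j) \<in> ferrers \<mu> \<and> (Suc i, j) \<in> ferrers \<mu> \<longrightarrow> T ! i ! j < T ! Suc i ! j)}"

definition inversions :: "nat list \<Rightarrow> (nat \<times> nat) set" where
  "inversions w = {(i, j). i < j \<and> j < length w \<and> w ! i > w ! j}"

definition word_sign :: "nat list \<Rightarrow> int" where
  "word_sign w = (- 1) ^ card (inversions w)"

definition tableau_sign :: "nat list list \<Rightarrow> int" where
  "tableau_sign T = word_sign (concat T)"

definition sign_imbalance :: "nat list \<Rightarrow> int" where
  "sign_imbalance \<mu> = (\<Sum>T\<in>SYT \<mu>. tableau_sign T)"

definition vertical_domino :: "nat \<times> nat \<Rightarrow> (nat \<times> nat) set" where
  "vertical_domino = (\<lambda>(i, j). {(i, j), (Suc i, j)})"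

definition vdomino_packings :: "nat list \<Rightarrow> (nat \<times> nat) set set set" where
  "vdomino_packings \<mu> =
     {D. D \<subseteq> range vertical_domino \<and> disjoint D \<and> \<Union>D \<subseteq> ferrers \<mu>}"

definition vdomino_number :: "nat list \<Rightarrow> nat" where
  "vdomino_number \<mu> = Max (card ` vdomino_packings \<mu>)"

text \<open>The sets over which sums and maxima are taken are finite, so neither
  \<^const>\<open>sum\<close> nor \<^const>\<open>Max\<close> takes a default value.\<close>

lemma finite_partitions_of: "finite (partitions_of n)"
proof (rule finite_subset)
  show "partitions_of n \<subseteq> {xs. set xs \<subseteq> {..n} \<and> length xs \<le> n}"
  proof
    fix xs assume xs: "xs \<in> partitions_of n"
    have "length ys \<le> sum_list ys" if "0 \<notin> set ys" for ys :: "nat list"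
      using that by (induction ys) auto
    then show "xs \<in> {xs. set xs \<subseteq> {..n} \<and> length xs \<le> n}"
      using xs by (auto simp: partitions_of_def member_le_sum_list)
  qed
qed (simp add: finite_lists_length_le)

lemma finite_SYT: "finite (SYT \<mu>)"
proof (rule finite_subset)
  let ?R = "{r. set r \<subseteq> {1..sum_list \<mu>} \<and> length r \<le> sum_list \<mu>}"
  show "SYT \<mu> \<subseteq> {T. set T \<subseteq> ?R \<and> length T = length \<mu>}"
  proof
    fix T assume "T \<in> SYT \<mu>"
    then have len: "map length T = \<mu>" and ent: "set (concat T) = {1..sum_list \<mu>}"
      by (simp_all add: SYT_def)
    have "r \<in> ?R" if "r \<in> set T" for r
    proof -
      have "length r \<in> set \<mu>" using that len by auto
      then have "length r \<le> sum_list \<mu>" by (simp add: member_le_sum_list)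
      moreover have "set r \<subseteq> {1..sum_list \<mu>}" using that ent by auto
      ultimately show ?thesis by simp
    qed
    moreover have "length T = length \<mu>" using len by auto
    ultimately show "T \<in> {T. set T \<subseteq> ?R \<and> length T = length \<mu>}" by blast
  qed
qed (simp add: finite_lists_length_eq finite_lists_length_le)

lemma finite_inversions: "finite (inversions w)"
  by (rule finite_subset[of _ "{..<length w} \<times> {..<length w}"]) (auto simp: inversions_def)

lemma finite_ferrers: "finite (ferrers \<mu>)"
proof -
  have "ferrers \<mu> = Sigma {..<length \<mu>} (\<lambda>i. {..<\<mu> ! i})"
    by (auto simp: ferrers_def)
  then show ?thesis by simp
qed

lemma vdomino_packings_finite_nonempty:
  "finite (vdomino_packings \<mu>)" "vdomino_packings \<mu> \<noteq> {}"
proof -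
  have "vdomino_packings \<mu> \<subseteq> Pow (Pow (ferrers \<mu>))"
    by (auto simp: vdomino_packings_def)
  then show "finite (vdomino_packings \<mu>)"
    by (rule finite_subset) (simp add: finite_ferrers)
  have "{} \<in> vdomino_packings \<mu>"
    by (simp add: vdomino_packings_def disjoint_def)
  then show "vdomino_packings \<mu> \<noteq> {}" by blast
qed

end

theory Submission
  imports Defs "HOL-Library.More_List" "HOL-Library.Multiset"
begin

text \<open>
  Removing the largest entry of a standard tableau gives \<open>I = U\<^sup>n \<emptyset>\<close>, where \<open>U\<close> adds a square to a
  shape in all possible ways, with sign \<open>(-1)\<close> to the number of squares in lower rows. Counting rows
  from 0, every vertical domino covers exactly one square in an odd row, and pairing each such square
  with the one above it gives a packing, so \<open>v(\<lambda>)\<close> is the number of squares in odd rows. The adjoint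
  \<open>D\<close> of \<open>U\<close> for the form \<open>\<langle>\<lambda>, \<lambda>\<rangle> = (-1)\<^bsup>v(\<lambda>)\<^esup>\<close> therefore removes squares with the same sign times the
  parity of the row. Adding and removing in different rows anticommute, the other contributions
  telescope along the outer and inner corners, and so \<open>D U + U D = 1\<close>. As \<open>D \<emptyset> = 0\<close>, it follows that
  \<open>D U\<^sup>n \<emptyset>\<close> is \<open>U\<^bsup>n-1\<^esup> \<emptyset>\<close> for odd \<open>n\<close> and \<open>0\<close> for even \<open>n\<close>. Hence \<open>\<langle>U\<^sup>n \<emptyset>, U\<^sup>n \<emptyset>\<rangle> = \<langle>U\<^bsup>n-1\<^esup> \<emptyset>, D U\<^sup>n \<emptyset>\<rangle>\<close>
  vanishes for even \<open>n > 0\<close>, and for odd \<open>n\<close> it equals \<open>\<langle>U\<^bsup>n-1\<^esup> \<emptyset>, U\<^bsup>n-1\<^esup> \<emptyset>\<rangle>\<close>.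
\<close>

section \<open>Shapes as row length functions\<close>

definition cells :: "(nat \<Rightarrow> nat) \<Rightarrow> (nat \<times> nat) set" where
  "cells f = {(i, j). j < f i}"

definition shape :: "(nat \<Rightarrow> nat) \<Rightarrow> bool" where
  "shape f \<longleftrightarrow> antimono f \<and> finite (cells f)"

definition shapes :: "nat \<Rightarrow> (nat \<Rightarrow> nat) set" where
  "shapes n = {f. shape f \<and> card (cells f) = n}"

definition add_box :: "nat \<Rightarrow> (nat \<Rightarrow> nat) \<Rightarrow> nat \<Rightarrow> nat" where
  "add_box r f = f(r := Suc (f r))"

definition remove_box :: "nat \<Rightarrow> (nat \<Rightarrow> nat) \<Rightarrow> nat \<Rightarrow> nat" where
  "remove_box r f = f(r := f r - 1)"

definition addable :: "(nat \<Rightarrow> nat) \<Rightarrow> nat \<Rightarrow> bool" where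
  "addable f r \<longleftrightarrow> r = 0 \<or> f r < f (r - 1)"

definition removable :: "(nat \<Rightarrow> nat) \<Rightarrow> nat \<Rightarrow> bool" where
  "removable f r \<longleftrightarrow> f (Suc r) < f r"

lemma shape_antimono_Suc: "shape f \<Longrightarrow> f (Suc r) \<le> f r"
  by (simp add: shape_def antimono_iff_le_Suc)

lemma finite_cells_shapes: "f \<in> shapes n \<Longrightarrow> finite (cells f)"
  by (simp add: shapes_def shape_def)

lemma remove_add_box [simp]: "remove_box r (add_box r f) = f"
  by (simp add: remove_box_def add_box_def)

lemma add_remove_box [simp]: "removable f r \<Longrightarrow> add_box r (remove_box r f) = f"
  by (auto simp: remove_box_def add_box_def removable_def)

lemma remove_add_box_commute:
  "r \<noteq> s \<Longrightarrow> remove_box s (add_box r f) = add_box r (remove_box s f)"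
  by (auto simp: remove_box_def add_box_def)

lemma cells_add_box: "cells (add_box r f) = insert (r, f r) (cells f)"
  by (auto simp: cells_def add_box_def split: if_splits)

lemma finite_cells_remove_box: "finite (cells f) \<Longrightarrow> finite (cells (remove_box r f))"
  by (rule finite_subset[of _ "cells f"]) (auto simp: cells_def remove_box_def split: if_splits)

lemma card_cells_add_box: "finite (cells f) \<Longrightarrow> card (cells (add_box r f)) = Suc (card (cells f))"
  by (simp add: cells_add_box) (simp add: cells_def)

lemma removable_add_box: "shape f \<Longrightarrow> removable (add_box r f) r"
  using shape_antimono_Suc[of f r] by (simp add: removable_def add_box_def)

lemma addable_remove_box: "shape f \<Longrightarrow> removable f r \<Longrightarrow> addable (remove_box r f) r"
  using shape_antimono_Suc[of f "r - 1"]
  by (cases r) (auto simp: addable_def removable_def remove_box_def)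

lemma addable_removable_commute:
  assumes "shape f" "r \<noteq> s"
  shows "addable f r \<and> removable (add_box r f) s \<longleftrightarrow>
    removable f s \<and> addable (remove_box s f) r"
  using assms shape_antimono_Suc[of f]
  by (cases r) (auto simp: addable_def removable_def add_box_def remove_box_def split: if_splits)

lemma shape_add_box:
  assumes "shape f" "addable f r"
  shows "shape (add_box r f)"
proof -
  have "add_box r f (Suc i) \<le> add_box r f i" for i
    using assms shape_antimono_Suc[of f i] by (auto simp: add_box_def addable_def)
  then show ?thesis using assms(1) by (simp add: shape_def antimono_iff_le_Suc cells_add_box)
qed

lemma shape_remove_box:
  assumes "shape f" "removable f r"
  shows "shape (remove_box r f)"
proof -
  have "remove_box r f (Suc i) \<le> remove_box r f i" for i
    using assms shape_antimono_Suc[of f i] by (auto simp: remove_box_def removable_def)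
  then show ?thesis
    using assms(1) by (simp add: shape_def antimono_iff_le_Suc finite_cells_remove_box)
qed

lemma add_box_in_shapes: "f \<in> shapes n \<Longrightarrow> addable f r \<Longrightarrow> add_box r f \<in> shapes (Suc n)"
  by (auto simp: shapes_def shape_add_box) (simp add: shape_def card_cells_add_box)

lemma remove_box_in_shapes:
  assumes "f \<in> shapes (Suc n)" "removable f r"
  shows "remove_box r f \<in> shapes n"
  using assms shape_remove_box[OF _ assms(2)] card_cells_add_box[of "remove_box r f" r]
  by (auto simp: shapes_def shape_def)

lemma bij_betw_add_box:
  "bij_betw (\<lambda>(f, r). (add_box r f, r))
    (SIGMA f:shapes n. {r. addable f r}) (SIGMA f:shapes (Suc n). {r. removable f r})"
  by (rule bij_betw_byWitness[where f' = "\<lambda>(f, r). (remove_box r f, r)"])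
    (auto simp: add_box_in_shapes remove_box_in_shapes,
     auto simp: shapes_def removable_add_box addable_remove_box)

lemma finite_removable:
  assumes "finite (cells f)"
  shows "finite {r. removable f r}"
proof (rule finite_subset)
  show "{r. removable f r} \<subseteq> fst ` cells f"
    by (force simp: cells_def removable_def image_iff)
qed (simp add: assms)

lemma Collect_addable_eq: "{r. addable f r} = insert 0 (Suc ` {r. removable f r})"
proof (rule set_eqI)
  fix r show "r \<in> {r. addable f r} \<longleftrightarrow> r \<in> insert 0 (Suc ` {r. removable f r})"
    by (cases r) (auto simp: addable_def removable_def)
qed

lemma finite_addable: "finite (cells f) \<Longrightarrow> finite {r. addable f r}"
  by (simp add: Collect_addable_eq finite_removable)

lemma sum_addable:
  fixes g :: "nat \<Rightarrow> 'a::comm_monoid_add"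
  assumes "finite (cells f)"
  shows "(\<Sum>r | addable f r. g r) = g 0 + (\<Sum>r | removable f r. g (Suc r))"
  using assms by (simp add: Collect_addable_eq finite_removable sum.reindex)


section \<open>Partitions and shapes\<close>

abbreviation row_length :: "nat list \<Rightarrow> nat \<Rightarrow> nat" where
  "row_length \<equiv> nth_default 0"

lemma ferrers_eq_cells: "ferrers \<mu> = cells (row_length \<mu>)"
  by (auto simp: ferrers_def cells_def nth_default_def split: if_splits)

lemma card_cells_rows_from:
  "card {c \<in> cells (row_length \<mu>). k \<le> fst c} = sum_list (drop k \<mu>)"
proof -
  have "{c \<in> cells (row_length \<mu>). k \<le> fst c} = (SIGMA i:{k..<length \<mu>}. {..<\<mu> ! i})"
    by (auto simp: cells_def nth_default_def split: if_splits)
  then have "card {c \<in> cells (row_length \<mu>). k \<le> fst c} = (\<Sum>i = k..<length \<mu>. \<mu> ! i)"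
    by simp
  also have "\<dots> = sum_list (drop k (map ((!) \<mu>) [0..<length \<mu>]))"
    by (simp add: drop_map interv_sum_list_conv_sum_set_nat del: map_nth)
  finally show ?thesis by (simp add: map_nth)
qed

lemma card_cells_row_length: "card (cells (row_length \<mu>)) = sum_list \<mu>"
  using card_cells_rows_from[of \<mu> 0] by simp

lemma row_length_in_shapes:
  assumes "\<mu> \<in> partitions_of n"
  shows "row_length \<mu> \<in> shapes n"
proof -
  have "row_length \<mu> (Suc i) \<le> row_length \<mu> i" for i
    using assms by (auto simp: partitions_of_def nth_default_def sorted_wrt_iff_nth_less)
  moreover have "finite (cells (row_length \<mu>))"
    using finite_ferrers[of \<mu>] by (simp add: ferrers_eq_cells)
  ultimately show ?thesis
    using assms
    by (simp add: shapes_def shape_def antimono_iff_le_Suc card_cells_row_length partitions_of_def)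
qed

lemma inj_on_row_length: "inj_on row_length (partitions_of n)"
proof (rule inj_onI)
  fix \<mu> \<nu> assume "\<mu> \<in> partitions_of n" "\<nu> \<in> partitions_of n" "row_length \<mu> = row_length \<nu>"
  moreover have "strip_while ((=) 0) \<mu> = \<mu>" if "\<mu> \<in> partitions_of n" for \<mu>
    using that by (cases \<mu> rule: rev_cases) (auto simp: partitions_of_def)
  ultimately show "\<mu> = \<nu>" by (metis nth_default_eq_iff)
qed

lemma shape_support:
  assumes "shape f"
  shows "\<exists>N. \<forall>i. 0 < f i \<longleftrightarrow> i < N"
proof -
  have "\<exists>i. f i = 0"
  proof (rule ccontr)
    assume "\<nexists>i. f i = 0"
    then have "range (\<lambda>i. (i, 0)) \<subseteq> cells f" by (auto simp: cells_def)
    then have "finite (range (\<lambda>i::nat. (i, 0::nat)))"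
      using assms by (auto simp: shape_def intro: finite_subset)
    then show False by (auto dest!: finite_imageD simp: inj_on_def)
  qed
  then have "f (LEAST i. f i = 0) = 0" by (rule LeastI_ex)
  then have "f i = 0" if "(LEAST i. f i = 0) \<le> i" for i
    using that assms antimonoD[of f] by (metis le_zero_eq shape_def)
  then have "0 < f i \<longleftrightarrow> i < (LEAST i. f i = 0)" for i
    using not_less_Least[of i "\<lambda>i. f i = 0"] by (metis leI less_irrefl gr0I)
  then show ?thesis by blast
qed

lemma shapes_subset_row_length: "shapes n \<subseteq> row_length ` partitions_of n"
proof
  fix f assume "f \<in> shapes n"
  then have "shape f" by (simp add: shapes_def)
  then obtain N where support: "\<And>i. 0 < f i \<longleftrightarrow> i < N" using shape_support by blast
  let ?\<mu> = "map f [0..<N]"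
  have f_eq: "f = row_length ?\<mu>"
  proof
    fix i show "f i = row_length ?\<mu> i" using support[of i] by (auto simp: nth_default_def)
  qed
  have "sum_list ?\<mu> = n"
    using \<open>f \<in> shapes n\<close> card_cells_row_length[of ?\<mu>] by (simp add: shapes_def flip: f_eq)
  moreover have "0 \<notin> set ?\<mu>" by (auto simp flip: support)
  moreover have "sorted_wrt (\<ge>) ?\<mu>"
    using \<open>shape f\<close> by (auto simp: sorted_wrt_iff_nth_less shape_def intro: antimonoD)
  ultimately show "f \<in> row_length ` partitions_of n"
    using f_eq by (auto simp: partitions_of_def)
qed

lemma bij_betw_row_length: "bij_betw row_length (partitions_of n) (shapes n)"
  unfolding bij_betw_def
  using inj_on_row_length shapes_subset_row_length row_length_in_shapes by blast

lemma finite_shapes: "finite (shapes n)"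
  using bij_betw_finite[OF bij_betw_row_length] finite_partitions_of by blast


section \<open>The signed up and down operators\<close>

definition row_sign :: "(nat \<Rightarrow> bool) \<Rightarrow> (nat \<Rightarrow> nat) \<Rightarrow> int" where
  "row_sign P f = (- 1) ^ card {c \<in> cells f. P (fst c)}"

abbreviation sign_below :: "nat \<Rightarrow> (nat \<Rightarrow> nat) \<Rightarrow> int" where
  "sign_below r \<equiv> row_sign (\<lambda>i. r < i)"

text \<open>A combination of shapes is represented by its coefficient function. The coefficient of \<open>U x\<close> at
  a shape therefore collects the coefficients of \<open>x\<close> at the shapes with one square less.\<close>

definition signed_up :: "((nat \<Rightarrow> nat) \<Rightarrow> int) \<Rightarrow> (nat \<Rightarrow> nat) \<Rightarrow> int" where
  "signed_up x f = (\<Sum>r | removable f r. sign_below r f * x (remove_box r f))"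

definition signed_down :: "((nat \<Rightarrow> nat) \<Rightarrow> int) \<Rightarrow> (nat \<Rightarrow> nat) \<Rightarrow> int" where
  "signed_down x f = (\<Sum>r | addable f r. (- 1) ^ r * sign_below r f * x (add_box r f))"

primrec imbalance :: "nat \<Rightarrow> (nat \<Rightarrow> nat) \<Rightarrow> int" where
  "imbalance 0 = (\<lambda>f. of_bool (f = (\<lambda>_. 0)))"
| "imbalance (Suc n) = signed_up (imbalance n)"

definition shape_form :: "nat \<Rightarrow> ((nat \<Rightarrow> nat) \<Rightarrow> int) \<Rightarrow> ((nat \<Rightarrow> nat) \<Rightarrow> int) \<Rightarrow> int" where
  "shape_form n x y = (\<Sum>f\<in>shapes n. row_sign odd f * (x f * y f))"

lemma row_sign_mult_self [simp]:
  "row_sign P f * row_sign P f = 1" "row_sign P f * (row_sign P f * a) = a"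
  by (simp_all add: row_sign_def flip: power_add mult.assoc)

lemma row_sign_add_box:
  assumes "finite (cells f)"
  shows "row_sign P (add_box r f) = (if P r then - row_sign P f else row_sign P f)"
proof -
  have "{c \<in> cells (add_box r f). P (fst c)} =
      (if P r then insert (r, f r) {c \<in> cells f. P (fst c)} else {c \<in> cells f. P (fst c)})"
    by (auto simp: cells_add_box)
  moreover have "(r, f r) \<notin> cells f" by (simp add: cells_def)
  ultimately show ?thesis using assms by (simp add: row_sign_def)
qed

lemma row_sign_remove_box:
  assumes "finite (cells f)" "removable f r"
  shows "row_sign P (remove_box r f) = (if P r then - row_sign P f else row_sign P f)"
  using row_sign_add_box[OF finite_cells_remove_box[OF assms(1)], of P r r] assms(2) by simp

lemma signed_up_adjoint: "shape_form (Suc n) (signed_up x) y = shape_form n x (signed_down y)"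
proof -
  let ?R = "SIGMA f:shapes (Suc n). {r. removable f r}"
  let ?A = "SIGMA f:shapes n. {r. addable f r}"
  let ?t = "\<lambda>(f, r). row_sign odd f * sign_below r f * x (remove_box r f) * y f"
  let ?u = "\<lambda>(f, r). row_sign odd f * x f * (- 1) ^ r * sign_below r f * y (add_box r f)"
  have "shape_form (Suc n) (signed_up x) y = sum ?t ?R"
    unfolding shape_form_def signed_up_def sum_distrib_left sum_distrib_right
    by (subst sum.Sigma)
      (auto simp: finite_shapes finite_removable finite_cells_shapes mult_ac intro!: sum.cong)
  also have "\<dots> = (\<Sum>p\<in>?A. ?t (case p of (f, r) \<Rightarrow> (add_box r f, r)))"
    by (rule sum.reindex_bij_betw[OF bij_betw_add_box, symmetric])
  also have "\<dots> = sum ?u ?A"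
    by (rule sum.cong) (auto simp: finite_cells_shapes row_sign_add_box mult_ac)
  also have "\<dots> = shape_form n x (signed_down y)"
    unfolding shape_form_def signed_down_def sum_distrib_left
    by (subst sum.Sigma)
      (auto simp: finite_shapes finite_addable finite_cells_shapes mult_ac intro!: sum.cong)
  finally show ?thesis .
qed

lemma sum_sum_diagonal:
  fixes g :: "'a \<Rightarrow> 'a \<Rightarrow> 'b::comm_monoid_add"
  assumes "finite A" "\<And>a. a \<in> A \<Longrightarrow> finite (B a)" "\<And>a. a \<in> A \<Longrightarrow> a \<in> B a"
  shows "(\<Sum>a\<in>A. \<Sum>b\<in>B a. g a b) =
    (\<Sum>a\<in>A. g a a) + (\<Sum>(a, b)\<in>(SIGMA a:A. B a - {a}). g a b)"
proof -
  have "(\<Sum>a\<in>A. \<Sum>b\<in>B a. g a b) = (\<Sum>a\<in>A. g a a + (\<Sum>b\<in>B a - {a}. g a b))"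
    using assms by (intro sum.cong refl sum.remove)
  then show ?thesis using assms by (simp add: sum.distrib sum.Sigma)
qed

definition add_remove_pairs :: "(nat \<Rightarrow> nat) \<Rightarrow> (nat \<times> nat) set" where
  "add_remove_pairs f = (SIGMA r:{r. addable f r}. {s. removable (add_box r f) s} - {r})"

definition add_remove_term ::
    "((nat \<Rightarrow> nat) \<Rightarrow> int) \<Rightarrow> (nat \<Rightarrow> nat) \<Rightarrow> nat \<times> nat \<Rightarrow> int" where
  "add_remove_term x f = (\<lambda>(r, s).
     (- 1) ^ r * sign_below r f * sign_below s (add_box r f) * x (remove_box s (add_box r f)))"

lemma signed_down_signed_up:
  assumes "shape f"
  shows "signed_down (signed_up x) f =
    (\<Sum>r | addable f r. (- 1) ^ r) * x f + sum (add_remove_term x f) (add_remove_pairs f)"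
proof -
  have fin: "finite (cells f)" using assms by (simp add: shape_def)
  have "signed_down (signed_up x) f =
      (\<Sum>r | addable f r. \<Sum>s | removable (add_box r f) s. add_remove_term x f (r, s))"
    by (simp add: signed_down_def signed_up_def add_remove_term_def sum_distrib_left mult_ac)
  also have "\<dots> = (\<Sum>r | addable f r. add_remove_term x f (r, r)) +
      sum (add_remove_term x f) (add_remove_pairs f)"
    using assms fin unfolding add_remove_pairs_def
    by (subst sum_sum_diagonal)
      (simp_all add: finite_addable finite_removable cells_add_box removable_add_box)
  also have "(\<Sum>r | addable f r. add_remove_term x f (r, r)) =
      (\<Sum>r | addable f r. (- 1) ^ r) * x f"
    using fin by (simp add: add_remove_term_def row_sign_add_box sum_distrib_right mult.assoc)
  finally show ?thesis .
qed

lemma signed_up_signed_down: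
  assumes "shape f"
  shows "signed_up (signed_down x) f =
    (\<Sum>s | removable f s. (- 1) ^ s) * x f - sum (add_remove_term x f) (add_remove_pairs f)"
proof -
  let ?Q = "SIGMA s:{s. removable f s}. {r. addable (remove_box s f) r} - {s}"
  let ?t = "\<lambda>s r. sign_below s f * (- 1) ^ r * sign_below r (remove_box s f) *
    x (add_box r (remove_box s f))"
  have fin: "finite (cells f)" using assms by (simp add: shape_def)
  have "signed_up (signed_down x) f =
      (\<Sum>s | removable f s. \<Sum>r | addable (remove_box s f) r. ?t s r)"
    by (simp add: signed_down_def signed_up_def sum_distrib_left mult_ac)
  also have "\<dots> = (\<Sum>s | removable f s. ?t s s) + (\<Sum>(s, r)\<in>?Q. ?t s r)"
    using assms fin
    by (intro sum_sum_diagonal)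
      (simp_all add: finite_addable finite_removable finite_cells_remove_box addable_remove_box)
  also have "(\<Sum>s | removable f s. ?t s s) = (\<Sum>s | removable f s. (- 1) ^ s) * x f"
    using fin by (simp add: row_sign_remove_box sum_distrib_left mult_ac)
  also have "(\<Sum>(s, r)\<in>?Q. ?t s r) = (\<Sum>p\<in>add_remove_pairs f. - add_remove_term x f p)"
  proof (rule sum.reindex_bij_witness[of _ prod.swap prod.swap])
    have swap_iff: "(r, s) \<in> add_remove_pairs f \<longleftrightarrow> (s, r) \<in> ?Q" for r s
      using addable_removable_commute[OF assms, of r s] by (auto simp: add_remove_pairs_def)
    show "prod.swap p \<in> add_remove_pairs f" if "p \<in> ?Q" for p
      using that by (cases p) (simp add: swap_iff)
    show "prod.swap p \<in> ?Q" if "p \<in> add_remove_pairs f" for p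
      using that by (cases p) (simp add: swap_iff)
    fix p assume "p \<in> ?Q"
    then obtain s r where pair: "p = (s, r)" "removable f s" "r \<noteq> s" by auto
    then have "- add_remove_term x f (r, s) = ?t s r"
      using fin by (cases "r < s")
        (auto simp: add_remove_term_def row_sign_remove_box row_sign_add_box
          remove_add_box_commute)
    then show "- add_remove_term x f (prod.swap p) = (case p of (s, r) \<Rightarrow> ?t s r)"
      by (simp add: pair)
  qed auto
  finally show ?thesis by (simp add: sum_negf)
qed

lemma signed_up_down_anticommute:
  assumes "shape f"
  shows "signed_down (signed_up x) f + signed_up (signed_down x) f = x f"
proof -
  have "(\<Sum>r | addable f r. (- 1) ^ r) + (\<Sum>r | removable f r. (- 1) ^ r) = (1 :: int)"
    using assms by (simp add: shape_def sum_addable sum_negf)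
  then show ?thesis
    by (simp add: signed_down_signed_up signed_up_signed_down assms flip: distrib_right)
qed

lemma signed_down_imbalance_0: "signed_down (imbalance 0) f = 0"
proof -
  have "add_box r f \<noteq> (\<lambda>_. 0)" for r by (auto simp: add_box_def fun_eq_iff)
  then show ?thesis by (simp add: signed_down_def)
qed

lemma signed_down_imbalance_Suc:
  assumes "shape f"
  shows "signed_down (imbalance (Suc n)) f = (if even n then imbalance n f else 0)"
  using assms
proof (induction n arbitrary: f)
  case 0
  have "signed_up (signed_down (imbalance 0)) f = 0"
    unfolding signed_up_def signed_down_imbalance_0 by simp
  then show ?case using signed_up_down_anticommute[OF 0, of "imbalance 0"] by simp
next
  case (Suc n)
  have "signed_up (signed_down (imbalance (Suc n))) f =
      (\<Sum>r | removable f r. sign_below r f * (if even n then imbalance n (remove_box r f) else 0))"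
    unfolding signed_up_def[of "signed_down _"]
    by (simp add: Suc.IH Suc.prems shape_remove_box del: imbalance.simps)
  also have "\<dots> = (if even n then imbalance (Suc n) f else 0)"
    by (simp add: signed_up_def)
  finally show ?case
    using signed_up_down_anticommute[OF Suc.prems, of "imbalance (Suc n)"]
    by (auto split: if_splits)
qed

lemma shape_form_imbalance_Suc:
  "shape_form (Suc n) (imbalance (Suc n)) (imbalance (Suc n)) =
    (if even n then shape_form n (imbalance n) (imbalance n) else 0)"
proof -
  have "shape_form (Suc n) (imbalance (Suc n)) (imbalance (Suc n)) =
      shape_form n (imbalance n) (signed_down (imbalance (Suc n)))"
    using signed_up_adjoint[of n "imbalance n" "imbalance (Suc n)"] by simp
  also have "\<dots> = (if even n then shape_form n (imbalance n) (imbalance n) else 0)"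
    unfolding shape_form_def
    by (simp add: shapes_def signed_down_imbalance_Suc del: imbalance.simps)
  finally show ?thesis .
qed

lemma shape_form_imbalance_eq_0:
  assumes "2 \<le> n"
  shows "shape_form n (imbalance n) (imbalance n) = 0"
proof -
  obtain m where "n = Suc (Suc m)" using assms by (metis add_2_eq_Suc le_Suc_ex)
  then show ?thesis by (simp only: shape_form_imbalance_Suc even_Suc) simp
qed


section \<open>Removing the largest entry of a tableau\<close>

definition shorten_row :: "nat \<Rightarrow> nat list \<Rightarrow> nat list" where
  "shorten_row r \<mu> = \<mu>[r := \<mu> ! r - 1]"

definition append_to_row :: "'a \<Rightarrow> nat \<Rightarrow> 'a list list \<Rightarrow> 'a list list" where
  "append_to_row m r T = T[r := T ! r @ [m]]"

definition increasing_rows :: "'a::linorder list list \<Rightarrow> bool" where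
  "increasing_rows T \<longleftrightarrow> (\<forall>i<length T. sorted_wrt (<) (T ! i))"

definition increasing_columns :: "'a::linorder list list \<Rightarrow> bool" where
  "increasing_columns T \<longleftrightarrow>
    (\<forall>i j. Suc i < length T \<and> j < length (T ! i) \<and> j < length (T ! Suc i) \<longrightarrow>
      T ! i ! j < T ! Suc i ! j)"

lemma removable_row_length:
  assumes "removable (row_length \<mu>) r"
  shows "r < length \<mu>" "0 < \<mu> ! r"
  using assms by (auto simp: removable_def nth_default_def split: if_splits)

lemma row_length_shorten_row: "row_length (shorten_row r \<mu>) = remove_box r (row_length \<mu>)"
  by (auto simp: shorten_row_def remove_box_def nth_default_def nth_list_update)

lemma sum_list_shorten_row:
  assumes "removable (row_length \<mu>) r"
  shows "sum_list \<mu> = Suc (sum_list (shorten_row r \<mu>))"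
proof -
  have "\<mu> ! r \<le> sum_list \<mu>"
    using removable_row_length[OF assms] by (simp add: member_le_sum_list)
  then show ?thesis
    using removable_row_length[OF assms] by (simp add: shorten_row_def sum_list_update)
qed

lemma sign_below_row_length: "sign_below r (row_length \<mu>) = (- 1) ^ sum_list (drop (Suc r) \<mu>)"
  using card_cells_rows_from[of \<mu> "Suc r"] by (simp add: row_sign_def Suc_le_eq)

lemma concat_split:
  assumes "r < length T"
  shows "concat T = (concat (take r T) @ T ! r) @ concat (drop (Suc r) T)"
  using arg_cong[OF id_take_nth_drop[OF assms], of concat] by simp

lemma concat_append_to_row:
  assumes "r < length T"
  shows "concat (append_to_row m r T) =
    (concat (take r T) @ T ! r) @ m # concat (drop (Suc r) T)"
  using assms by (simp add: append_to_row_def upd_conv_take_nth_drop)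

lemma mset_concat_append_to_row:
  assumes "r < length T"
  shows "mset (concat (append_to_row m r T)) = add_mset m (mset (concat T))"
  using arg_cong[OF concat_split[OF assms], of mset] by (simp add: concat_append_to_row assms)

lemma length_append_to_row [simp]: "length (append_to_row m r T) = length T"
  by (simp add: append_to_row_def)

lemma nth_append_to_row:
  "i < length T \<Longrightarrow> append_to_row m r T ! i = (if i = r then T ! i @ [m] else T ! i)"
  by (simp add: append_to_row_def)

lemma nth_nth_in_set_concat:
  "i < length T \<Longrightarrow> j < length (T ! i) \<Longrightarrow> T ! i ! j \<in> set (concat T)"
  by (auto intro!: bexI[of _ "T ! i"])

lemma append_to_row_inject:
  assumes "append_to_row m r T = append_to_row m s S"
    and "r < length T" "s < length S" "m \<notin> set (concat T)" "m \<notin> set (concat S)"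
  shows "r = s \<and> T = S"
proof -
  have len: "length T = length S" using assms(1) by (metis length_append_to_row)
  have row: "append_to_row m r T ! i = append_to_row m s S ! i" for i using assms(1) by simp
  have "r = s"
  proof (rule ccontr)
    assume "r \<noteq> s"
    then have "S ! r = T ! r @ [m]" using row[of r] assms(2) len by (simp add: nth_append_to_row)
    then have "m \<in> set (S ! r)" by simp
    moreover have "S ! r \<in> set S" using assms(2) len by simp
    ultimately show False using assms(5) by auto
  qed
  moreover have "T = S"
  proof (rule nth_equalityI)
    fix i assume "i < length T"
    then show "T ! i = S ! i"
      using row[of i] len \<open>r = s\<close> by (simp add: nth_append_to_row split: if_splits)
  qed (rule len)
  ultimately show ?thesis by simp
qed

lemma map_length_append_to_row:
  assumes "removable (row_length \<mu>) r"
  shows "map length (append_to_row m r T) = \<mu> \<longleftrightarrow> map length T = shorten_row r \<mu>"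
  using removable_row_length[OF assms]
  by (auto simp: list_eq_iff_nth_eq shorten_row_def append_to_row_def nth_list_update
      split: if_splits)

lemma increasing_rows_append_to_row:
  assumes "r < length T" "\<forall>x\<in>set (concat T). x < m"
  shows "increasing_rows (append_to_row m r T) \<longleftrightarrow> increasing_rows T"
proof -
  have "\<forall>x\<in>set (T ! r). x < m" using assms nth_mem[of r T] by auto
  then have "sorted_wrt (<) (append_to_row m r T ! i) \<longleftrightarrow> sorted_wrt (<) (T ! i)"
    if "i < length T" for i
    using that by (auto simp: nth_append_to_row sorted_wrt_append)
  then show ?thesis by (simp add: increasing_rows_def)
qed

lemma increasing_columns_append_to_row:
  assumes "\<forall>x\<in>set (concat T). x < m"
    and outer: "Suc r < length T \<Longrightarrow> length (T ! Suc r) \<le> length (T ! r)"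
  shows "increasing_columns (append_to_row m r T) \<longleftrightarrow> increasing_columns T"
proof -
  let ?T = "append_to_row m r T"
  let ?dom = "\<lambda>T i j. j < length (T ! i) \<and> j < length (T ! Suc i)"
  have "(?dom ?T i j \<longrightarrow> ?T ! i ! j < ?T ! Suc i ! j) \<longleftrightarrow> (?dom T i j \<longrightarrow> T ! i ! j < T ! Suc i ! j)"
    if i: "Suc i < length T" for i j
  proof (cases "?dom T i j")
    case True
    then have "?dom ?T i j" "?T ! i ! j = T ! i ! j" "?T ! Suc i ! j = T ! Suc i ! j"
      using i by (auto simp: nth_append_to_row nth_append)
    then show ?thesis using True by simp
  next
    case False
    have "?T ! i ! j < ?T ! Suc i ! j" if "?dom ?T i j"
    proof -
      have "j < length (T ! i)" "Suc i = r" "j = length (T ! Suc i)"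
        using that i False outer by (auto simp: nth_append_to_row less_Suc_eq split: if_splits)
      then show ?thesis
        using assms(1) nth_nth_in_set_concat[of i T j] i
        by (simp add: nth_append_to_row del: set_concat)
    qed
    then show ?thesis using False by blast
  qed
  then show ?thesis unfolding increasing_columns_def length_append_to_row by blast
qed

lemma distinct_set_iff_mset:
  assumes "finite A"
  shows "distinct xs \<and> set xs = A \<longleftrightarrow> mset xs = mset_set A"
proof
  assume "mset xs = mset_set A"
  moreover obtain ys where ys: "set ys = A" "distinct ys"
    using finite_distinct_list[OF assms] by blast
  ultimately have "mset xs = mset ys" by (metis mset_set_set)
  then show "distinct xs \<and> set xs = A"
    using ys mset_eq_imp_distinct_iff mset_eq_setD by metis
qed (auto simp: mset_set_set)

lemma SYT_iff:
  "T \<in> SYT \<mu> \<longleftrightarrow> map length T = \<mu> \<and> mset (concat T) = mset_set {1..sum_list \<mu>} \<and>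
    increasing_rows T \<and> increasing_columns T"
proof (cases "map length T = \<mu>")
  case True
  then have ferrers: "(i, j) \<in> ferrers \<mu> \<longleftrightarrow> i < length T \<and> j < length (T ! i)" for i j
    by (auto simp: ferrers_def)
  have "increasing_rows T \<longleftrightarrow>
      (\<forall>i j. (i, j) \<in> ferrers \<mu> \<and> (i, Suc j) \<in> ferrers \<mu> \<longrightarrow> T ! i ! j < T ! i ! Suc j)"
    unfolding increasing_rows_def ferrers by (auto simp: sorted_wrt_iff_nth_Suc_transp)
  moreover have "increasing_columns T \<longleftrightarrow>
      (\<forall>i j. (i, j) \<in> ferrers \<mu> \<and> (Suc i, j) \<in> ferrers \<mu> \<longrightarrow> T ! i ! j < T ! Suc i ! j)"
    unfolding increasing_columns_def ferrers by auto
  ultimately show ?thesis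
    using True distinct_set_iff_mset[of "{1..sum_list \<mu>}" "concat T"]
    unfolding SYT_def mem_Collect_eq by blast
qed (simp add: SYT_def)

lemma SYT_map_length: "T \<in> SYT \<mu> \<Longrightarrow> map length T = \<mu>"
  by (simp add: SYT_def)

lemma SYT_length: "T \<in> SYT \<mu> \<Longrightarrow> length T = length \<mu>"
  using SYT_map_length by (metis length_map)

lemma SYT_entries: "T \<in> SYT \<mu> \<Longrightarrow> set (concat T) = {1..sum_list \<mu>}"
  by (simp add: SYT_def)

lemma append_to_row_in_SYT_iff:
  assumes removable: "removable (row_length \<mu>) r"
  shows "append_to_row (sum_list \<mu>) r T \<in> SYT \<mu> \<longleftrightarrow> T \<in> SYT (shorten_row r \<mu>)"
proof (cases "map length T = shorten_row r \<mu>")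
  case lengths: True
  let ?n = "sum_list (shorten_row r \<mu>)"
  let ?T = "append_to_row (sum_list \<mu>) r T"
  have row: "r < length T"
    using removable_row_length[OF removable] arg_cong[OF lengths, of length] by (simp add: shorten_row_def)
  have "mset_set {1..sum_list \<mu>} = add_mset (sum_list \<mu>) (mset_set {1..?n})"
    by (simp add: sum_list_shorten_row[OF removable] atLeastAtMostSuc_conv)
  then have entries:
    "mset (concat ?T) = mset_set {1..sum_list \<mu>} \<longleftrightarrow> mset (concat T) = mset_set {1..?n}"
    by (simp add: mset_concat_append_to_row[OF row] del: mset_concat)
  have "increasing_rows ?T \<longleftrightarrow> increasing_rows T" "increasing_columns ?T \<longleftrightarrow> increasing_columns T"
    if same_entries: "mset (concat T) = mset_set {1..?n}"
  proof -
    have "set (concat T) = {1..?n}" using arg_cong[OF same_entries, of set_mset] by simp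
    then have entries_less: "\<forall>x\<in>set (concat T). x < sum_list \<mu>"
      by (simp add: sum_list_shorten_row[OF removable] del: set_concat)
    have "length (T ! i) = shorten_row r \<mu> ! i" if "i < length T" for i
      using that lengths by (metis nth_map)
    then have "length (T ! Suc r) \<le> length (T ! r)" if "Suc r < length T"
      using that removable row arg_cong[OF lengths, of length]
      by (auto simp: shorten_row_def removable_def nth_default_def)
    then show "increasing_rows ?T \<longleftrightarrow> increasing_rows T"
      "increasing_columns ?T \<longleftrightarrow> increasing_columns T"
      using increasing_rows_append_to_row[OF row entries_less]
        increasing_columns_append_to_row[OF entries_less] by blast+
  qed
  then show ?thesis
    unfolding SYT_iff map_length_append_to_row[OF removable] entries by blast
qed (simp add: SYT_iff map_length_append_to_row[OF removable])

lemma SYT_remove_largest: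
  assumes tableau: "T \<in> SYT \<mu>" and pos: "0 < sum_list \<mu>"
  obtains r S where "removable (row_length \<mu>) r" "T = append_to_row (sum_list \<mu>) r S"
proof -
  let ?m = "sum_list \<mu>"
  have lengths: "map length T = \<mu>" and rows: "increasing_rows T" and cols: "increasing_columns T"
    using tableau by (simp_all add: SYT_iff)
  have row_length: "row_length \<mu> i = (if i < length T then length (T ! i) else 0)" for i
    using lengths by (auto simp: nth_default_def)
  have entry_le: "T ! i ! j \<le> ?m" if "i < length T" "j < length (T ! i)" for i j
    using nth_nth_in_set_concat[OF that] unfolding SYT_entries[OF tableau] by simp
  have "?m \<in> set (concat T)" unfolding SYT_entries[OF tableau] using pos by simp
  then obtain r j where row: "r < length T" and column: "j < length (T ! r)"
    and largest: "T ! r ! j = ?m"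
    by (auto simp: in_set_conv_nth)
  have last: "length (T ! r) = Suc j"
  proof (rule ccontr)
    assume "length (T ! r) \<noteq> Suc j"
    then have "Suc j < length (T ! r)" using column by simp
    moreover from this have "T ! r ! j < T ! r ! Suc j"
      using rows row by (simp add: increasing_rows_def sorted_wrt_iff_nth_less)
    ultimately show False using entry_le[OF row] largest by (metis not_le)
  qed
  have "row_length \<mu> (Suc r) \<le> j"
  proof (rule ccontr)
    assume "\<not> row_length \<mu> (Suc r) \<le> j"
    then have below: "Suc r < length T" "j < length (T ! Suc r)"
      by (auto simp: row_length split: if_splits)
    then have "T ! r ! j < T ! Suc r ! j" using cols column unfolding increasing_columns_def by blast
    then show False using entry_le[OF below] largest by simp
  qed
  then have "removable (row_length \<mu>) r" using row last by (simp add: removable_def row_length)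
  moreover have "T ! r = butlast (T ! r) @ [?m]"
    using column last largest
    by (metis append_butlast_last_id diff_Suc_1 last_conv_nth length_greater_0_conv zero_less_Suc)
  then have "T = append_to_row ?m r (T[r := butlast (T ! r)])"
    using row by (simp add: append_to_row_def)
  ultimately show thesis by (rule that)
qed

lemma bij_betw_append_to_row:
  assumes pos: "0 < sum_list \<mu>"
  shows "bij_betw (\<lambda>(r, T). append_to_row (sum_list \<mu>) r T)
    (SIGMA r:{r. removable (row_length \<mu>) r}. SYT (shorten_row r \<mu>)) (SYT \<mu>)"
    (is "bij_betw ?app ?P _")
  unfolding bij_betw_def
proof
  have in_domain: "r < length T \<and> sum_list \<mu> \<notin> set (concat T)" if "(r, T) \<in> ?P" for r T
    using that removable_row_length[of \<mu> r] sum_list_shorten_row[of \<mu> r]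
    by (auto simp: SYT_length SYT_entries shorten_row_def simp del: set_concat)
  show "inj_on ?app ?P"
  proof (rule inj_onI, clarify)
    fix r T s S
    assume "removable (row_length \<mu>) r" "T \<in> SYT (shorten_row r \<mu>)"
      and "removable (row_length \<mu>) s" "S \<in> SYT (shorten_row s \<mu>)"
      and "append_to_row (sum_list \<mu>) r T = append_to_row (sum_list \<mu>) s S"
    then show "r = s \<and> T = S"
      using in_domain[of r T] in_domain[of s S] by (intro append_to_row_inject) blast+
  qed
  show "?app ` ?P = SYT \<mu>"
  proof (intro set_eqI iffI)
    fix T assume tableau: "T \<in> SYT \<mu>"
    then obtain r S where "removable (row_length \<mu>) r" "T = append_to_row (sum_list \<mu>) r S"
      using pos by (rule SYT_remove_largest)
    then show "T \<in> ?app ` ?P" using tableau by (auto simp: append_to_row_in_SYT_iff image_iff)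
  qed (auto simp: append_to_row_in_SYT_iff)
qed

lemma card_inversions_Cons:
  "card (inversions (x # w)) = length (filter (\<lambda>y. y < x) w) + card (inversions w)"
proof -
  have "inversions (x # w) =
      (\<lambda>j. (0, Suc j)) ` {j. j < length w \<and> w ! j < x} \<union> map_prod Suc Suc ` inversions w"
    (is "_ = ?A \<union> ?B")
  proof (rule set_eqI)
    fix p show "p \<in> inversions (x # w) \<longleftrightarrow> p \<in> ?A \<union> ?B"
      by (cases p; cases "fst p"; cases "snd p") (auto simp: inversions_def image_iff)
  qed
  moreover have "?A \<inter> ?B = {}" by auto
  moreover have "card ?A = length (filter (\<lambda>y. y < x) w)"
    by (simp add: card_image inj_on_def length_filter_conv_card)
  moreover have "card ?B = card (inversions w)"
    by (intro card_image) (auto simp: inj_on_def)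
  ultimately show ?thesis by (simp add: card_Un_disjoint finite_inversions)
qed

lemma word_sign_insert_max:
  assumes "\<forall>x\<in>set (u @ v). x < m"
  shows "word_sign (u @ m # v) = (- 1) ^ length v * word_sign (u @ v)"
proof -
  have "card (inversions (u @ m # v)) = length v + card (inversions (u @ v))"
    using assms by (induction u) (simp_all add: card_inversions_Cons filter_id_conv)
  then show ?thesis by (simp add: word_sign_def power_add)
qed

lemma tableau_sign_append_to_row:
  assumes "r < length T" "\<forall>x\<in>set (concat T). x < m"
  shows "tableau_sign (append_to_row m r T) =
    (- 1) ^ length (concat (drop (Suc r) T)) * tableau_sign T"
  using assms(2)
  unfolding tableau_sign_def concat_append_to_row[OF assms(1)] concat_split[OF assms(1)]
  by (rule word_sign_insert_max)

lemma sign_imbalance_rec: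
  assumes "0 < sum_list \<mu>"
  shows "sign_imbalance \<mu> =
    (\<Sum>r | removable (row_length \<mu>) r.
      sign_below r (row_length \<mu>) * sign_imbalance (shorten_row r \<mu>))"
proof -
  let ?R = "{r. removable (row_length \<mu>) r}"
  let ?P = "SIGMA r:?R. SYT (shorten_row r \<mu>)"
  have sign: "tableau_sign (append_to_row (sum_list \<mu>) r T) =
      sign_below r (row_length \<mu>) * tableau_sign T"
    if removable: "removable (row_length \<mu>) r" and tableau: "T \<in> SYT (shorten_row r \<mu>)" for r T
  proof -
    have "r < length T"
      using removable_row_length[OF removable] SYT_length[OF tableau] by (simp add: shorten_row_def)
    moreover have "\<forall>x\<in>set (concat T). x < sum_list \<mu>"
      by (simp add: SYT_entries[OF tableau] sum_list_shorten_row[OF removable] del: set_concat)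
    moreover have "map length (drop (Suc r) T) = drop (Suc r) \<mu>"
      using tableau by (simp add: SYT_iff shorten_row_def flip: drop_map)
    ultimately show ?thesis
      by (simp add: tableau_sign_append_to_row sign_below_row_length length_concat)
  qed
  have "sign_imbalance \<mu> =
      (\<Sum>p\<in>?P. tableau_sign (case p of (r, T) \<Rightarrow> append_to_row (sum_list \<mu>) r T))"
    unfolding sign_imbalance_def
    by (rule sum.reindex_bij_betw[OF bij_betw_append_to_row[OF assms], symmetric])
  also have "\<dots> = (\<Sum>(r, T)\<in>?P. sign_below r (row_length \<mu>) * tableau_sign T)"
    by (intro sum.cong refl) (auto simp: sign)
  also have "\<dots> =
      (\<Sum>r\<in>?R. \<Sum>T\<in>SYT (shorten_row r \<mu>). sign_below r (row_length \<mu>) * tableau_sign T)"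
    using finite_ferrers[of \<mu>]
    by (intro sum.Sigma[symmetric]) (simp_all add: finite_removable finite_SYT ferrers_eq_cells)
  finally show ?thesis by (simp add: sign_imbalance_def sum_distrib_left)
qed

lemma SYT_sum_list_0:
  assumes "sum_list \<mu> = 0"
  shows "SYT \<mu> = {replicate (length \<mu>) []}"
proof (intro equalityI subsetI)
  fix T assume tableau: "T \<in> SYT \<mu>"
  have "length row = 0" if "row \<in> set T" for row
  proof -
    have "length row \<in> set \<mu>" using that SYT_map_length[OF tableau] by (metis image_eqI set_map)
    then show ?thesis using assms by (metis sum_list_eq_0_iff)
  qed
  then have "T = replicate (length \<mu>) []"
    using SYT_length[OF tableau] by (intro replicate_eqI) auto
  then show "T \<in> {replicate (length \<mu>) []}" by simp
next
  have "replicate (length \<mu>) 0 = \<mu>" using assms by (intro replicate_eqI[symmetric]) auto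
  moreover fix T :: "nat list list" assume "T \<in> {replicate (length \<mu>) []}"
  ultimately show "T \<in> SYT \<mu>"
    using assms by (simp add: SYT_iff increasing_rows_def increasing_columns_def)
qed

lemma sign_imbalance_eq_imbalance: "sign_imbalance \<mu> = imbalance (sum_list \<mu>) (row_length \<mu>)"
proof (induction "sum_list \<mu>" arbitrary: \<mu>)
  case 0
  have "sign_imbalance \<mu> = 1"
    unfolding sign_imbalance_def SYT_sum_list_0[OF 0[symmetric]]
    by (simp add: tableau_sign_def word_sign_def inversions_def)
  moreover have "\<forall>i<length \<mu>. \<mu> ! i = 0" using 0[symmetric] by simp
  then have "row_length \<mu> = (\<lambda>_. 0)" by (auto simp: nth_default_def)
  ultimately show ?case unfolding 0[symmetric] by simp
next
  case (Suc n)
  have "sign_imbalance (shorten_row r \<mu>) = imbalance n (remove_box r (row_length \<mu>))"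
    if "removable (row_length \<mu>) r" for r
  proof -
    have "n = sum_list (shorten_row r \<mu>)"
      using Suc.hyps(2) sum_list_shorten_row[OF that] by simp
    then show ?thesis using Suc.hyps(1) by (simp add: row_length_shorten_row)
  qed
  then show ?case
    using sign_imbalance_rec[of \<mu>] Suc.hyps(2)[symmetric] by (simp add: signed_up_def)
qed


section \<open>Vertical dominoes\<close>

lemma card_vdomino_packing_le:
  assumes "D \<in> vdomino_packings \<mu>"
  shows "card D \<le> card {c \<in> ferrers \<mu>. odd (fst c)}"
proof -
  have packing: "D \<subseteq> range vertical_domino" "disjoint D" "\<Union>D \<subseteq> ferrers \<mu>"
    using assms by (auto simp: vdomino_packings_def)
  have "\<exists>c\<in>d. odd (fst c)" if "d \<in> D" for d
    using that packing(1) by (auto simp: vertical_domino_def)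
  then obtain g where odd_square: "\<And>d. d \<in> D \<Longrightarrow> g d \<in> d \<and> odd (fst (g d))" by metis
  have "inj_on g D"
  proof (rule inj_onI, rule ccontr)
    fix d e assume "d \<in> D" "e \<in> D" "g d = g e" "d \<noteq> e"
    then show False using odd_square[of d] odd_square[of e] disjointD[OF packing(2), of d e] by auto
  qed
  moreover have "g ` D \<subseteq> {c \<in> ferrers \<mu>. odd (fst c)}" using odd_square packing(3) by blast
  ultimately show ?thesis by (rule card_inj_on_le) (simp add: finite_ferrers)
qed

lemma card_odd_rows_in_card_vdomino_packings:
  assumes "antimono (row_length \<mu>)"
  shows "card {c \<in> ferrers \<mu>. odd (fst c)} \<in> card ` vdomino_packings \<mu>"
proof (rule image_eqI)
  let ?E = "{(i, j). even i \<and> (Suc i, j) \<in> ferrers \<mu>}"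
  let ?D = "vertical_domino ` ?E"
  have "(i, j) \<in> ferrers \<mu>" if "(Suc i, j) \<in> ferrers \<mu>" for i j
    using that assms
    by (force simp: ferrers_eq_cells cells_def antimono_iff_le_Suc intro: less_le_trans)
  then have "\<Union>?D \<subseteq> ferrers \<mu>" by (auto simp: vertical_domino_def)
  moreover have "disjoint ?D" by (auto simp: disjoint_def vertical_domino_def)
  ultimately show "?D \<in> vdomino_packings \<mu>" by (auto simp: vdomino_packings_def)
  have "inj vertical_domino" by (auto simp: inj_def vertical_domino_def doubleton_eq_iff)
  then have "card ?D = card ?E" by (meson card_image inj_on_subset subset_UNIV)
  also have "\<dots> = card (map_prod Suc id ` ?E)" by (simp add: card_image inj_on_def)
  also have "map_prod Suc id ` ?E = {c \<in> ferrers \<mu>. odd (fst c)}"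
    by (force elim: oddE)
  finally show "card {c \<in> ferrers \<mu>. odd (fst c)} = card ?D" by (rule sym)
qed

lemma vdomino_number_eq_card_odd_rows:
  assumes "antimono (row_length \<mu>)"
  shows "vdomino_number \<mu> = card {c \<in> ferrers \<mu>. odd (fst c)}"
  unfolding vdomino_number_def
  using card_vdomino_packing_le card_odd_rows_in_card_vdomino_packings[OF assms]
  by (intro Max_eqI) (auto simp: vdomino_packings_finite_nonempty)

theorem theorem3p6:
  fixes n :: nat
  assumes "n \<ge> 2"
  shows "(\<Sum>\<mu>\<in>partitions_of n. (- 1) ^ vdomino_number \<mu> * (sign_imbalance \<mu>)\<^sup>2) = 0"
proof -
  have "(- 1) ^ vdomino_number \<mu> * (sign_imbalance \<mu>)\<^sup>2 =
      row_sign odd (row_length \<mu>) * (imbalance n (row_length \<mu>) * imbalance n (row_length \<mu>))"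
    if "\<mu> \<in> partitions_of n" for \<mu>
    using that row_length_in_shapes[OF that]
    by (simp add: vdomino_number_eq_card_odd_rows sign_imbalance_eq_imbalance shapes_def
        shape_def row_sign_def ferrers_eq_cells partitions_of_def power2_eq_square)
  then have "(\<Sum>\<mu>\<in>partitions_of n. (- 1) ^ vdomino_number \<mu> * (sign_imbalance \<mu>)\<^sup>2) =
      shape_form n (imbalance n) (imbalance n)"
    unfolding shape_form_def by (simp add: sum.reindex_bij_betw[OF bij_betw_row_length, symmetric])
  also have "\<dots> = 0" using assms by (rule shape_form_imbalance_eq_0)
  finally show ?thesis .
qed

end
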